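(* Let $n$ be a positive integer, $X=\{1,2,\dots,n\}$, and let $\alpha$ be a real number. If $\mathcal{A}\subseteq\mathcal{P}(X)$ with $|\mathcal{A}|=\alpha 2^n$, then $c(\mathcal{A})\leq\alpha\, n!$.
   Context: For a positive integer $n$, let $X=\{1,2,\dots,n\}$ and let $\mathcal{P}(X)$ be its power set, ordered by inclusion. A maximal chain is a chain of $n+1$ elements in $\mathcal{P}(X)$, i.e. a collection $\emptyset=A_0\subset A_1\subset\dots\subset A_n=X$ with $|A_r|=r$ for each $r$ (it is maximal in $\mathcal{P}(X)$, not merely within a given family). For $\mathcal{A}\subseteq\mathcal{P}(X)$, $c(\mathcal{A})$ denotes the number of maximal chains in $\mathcal{A}$, that is, the number of maximal chains of $\mathcal{P}(X)$ all of whose $n+1$ members belong to $\mathcal{A}$. *)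

theory Defs
  imports Complex_Main
begin

definition maximal_chain :: "nat \<Rightarrow> nat set set \<Rightarrow> bool" where
  "maximal_chain n C \<longleftrightarrow> subset.chain (Pow {1..n}) C \<and> card C = n + 1"

definition num_maximal_chains :: "nat \<Rightarrow> nat set set \<Rightarrow> nat" where
  "num_maximal_chains n \<A> = card {C. maximal_chain n C \<and> C \<subseteq> \<A>}"

end

theory Submission
  imports Defs
begin

text \<open>
  A maximal chain has exactly one member on each level of the cube. For a fixed level \<open>k\<close> one can
  therefore count the maximal chains inside \<open>\<A>\<close> by the member of size \<open>k\<close> through which they pass.
  At most \<open>k! (n - k)!\<close> maximal chains pass through a given \<open>k\<close>-set
  (\<open>card_full_chains_through_le\<close>), so if \<open>a\<^sub>k\<close> is the number of \<open>k\<close>-sets in \<open>\<A>\<close>, then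
  \<open>c(\<A>) \<le> a\<^sub>k k! (n - k)!\<close>, that is, \<open>c(\<A>) (n choose k) \<le> a\<^sub>k n!\<close>: the proportion of maximal chains
  that lie in \<open>\<A>\<close> is at most the proportion of \<open>k\<close>-sets that lie in \<open>\<A>\<close>
  (\<open>card_full_chains_level_le\<close>). Summing over all \<open>k\<close> gives \<open>c(\<A>) 2\<^sup>n \<le> |\<A>| n!\<close>; in
  other words, the smallest of these proportions is at most their binomially weighted average.
\<close>

text \<open>The ground set is arbitrary, because the counts below proceed by deleting elements of it.\<close>

definition full_chains :: "'a set \<Rightarrow> 'a set set set" where
  "full_chains X = {C. subset.chain (Pow X) C \<and> card C = card X + 1}"

lemma full_chainsD:
  assumes "C \<in> full_chains X"
  shows "C \<subseteq> Pow X" and "card C = card X + 1"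
    and "\<And>A B. A \<in> C \<Longrightarrow> B \<in> C \<Longrightarrow> A \<subseteq> B \<or> B \<subseteq> A"
  using assms by (auto simp: full_chains_def subset_chain_def)

lemma finite_full_chains:
  assumes "finite X"
  shows "finite (full_chains X)"
proof (rule finite_subset)
  show "full_chains X \<subseteq> Pow (Pow X)"
    using full_chainsD(1) by blast
qed (use assms in simp)

text \<open>
  Comparable finite sets of equal size coincide, so the \<open>card X + 1\<close> members of the chain have
  distinct sizes, and only the \<open>card X + 1\<close> sizes \<open>0, \<dots>, card X\<close> are possible.
\<close>

lemma bij_betw_card_full_chain:
  assumes "finite X" and C: "C \<in> full_chains X"
  shows "bij_betw card C {..card X}"
proof -
  note CD = full_chainsD[OF C]
  have "inj_on card C"
  proof (rule inj_onI)
    fix A B assume "A \<in> C" "B \<in> C" "card A = card B"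
    moreover from this have "finite A" "finite B"
      using CD(1) assms(1) by (auto intro: finite_subset)
    ultimately show "A = B"
      using CD(3)[of A B] card_subset_eq by metis
  qed
  moreover have "card ` C = {..card X}"
  proof (rule card_subset_eq)
    show "card ` C \<subseteq> {..card X}"
      using CD(1) assms(1) by (auto intro: card_mono)
    show "card (card ` C) = card {..card X}"
      using \<open>inj_on card C\<close> CD(2) by (simp add: card_image)
  qed simp
  ultimately show ?thesis
    by (simp add: bij_betw_def)
qed

lemma full_chain_level:
  assumes "finite X" "C \<in> full_chains X" "k \<le> card X"
  obtains A where "A \<in> C" "card A = k"
  using bij_betw_card_full_chain[OF assms(1,2)] assms(3) by (force simp: bij_betw_def)

text \<open>
  The second largest member of a maximal chain misses a single point \<open>x\<close>, and every smaller member
  lies below it. Removing the top thus leaves a maximal chain over \<open>X - {x}\<close>.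
\<close>

lemma full_chain_remove_top:
  assumes "finite X" and C: "C \<in> full_chains X" and "X \<noteq> {}"
  obtains x D where "x \<in> X" "D \<in> full_chains (X - {x})" "X - {x} \<in> D" "C = insert X D"
proof -
  note CD = full_chainsD[OF C]
  have pos: "card X > 0"
    using assms by (simp add: card_gt_0_iff)
  obtain A where A: "A \<in> C" "card A = card X - 1"
    using full_chain_level[OF assms(1) C] by (metis diff_le_self)
  obtain T where T: "T \<in> C" "card T = card X"
    using full_chain_level[OF assms(1) C] by blast
  have "X \<in> C"
    using T CD(1) card_subset_eq[OF assms(1), of T] by auto
  have "A \<subseteq> X"
    using A CD(1) by auto
  then have "card (X - A) = 1"
    using A pos assms(1) by (simp add: card_Diff_subset finite_subset)
  then obtain x where x: "X - A = {x}"
    by (auto simp: card_1_singleton_iff)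
  with \<open>A \<subseteq> X\<close> have Ax: "A = X - {x}" "x \<in> X"
    by auto
  have below: "B \<subseteq> A" if "B \<in> C - {X}" for B
  proof -
    have "B \<subseteq> X" "B \<noteq> X"
      using that CD(1) by auto
    \<comment> \<open>nothing lies strictly between \<open>X - {x}\<close> and \<open>X\<close>\<close>
    moreover have "B = A \<or> B = X" if "A \<subseteq> B"
      using that \<open>B \<subseteq> X\<close> Ax by auto
    ultimately show ?thesis
      using CD(3)[OF A(1), of B] that by auto
  qed
  have "card (C - {X}) = card (X - {x}) + 1"
    using CD(2) \<open>X \<in> C\<close> assms(1) Ax(2) pos by simp
  moreover have "C - {X} \<subseteq> Pow (X - {x})"
    using below Ax(1) by blast
  ultimately have "C - {X} \<in> full_chains (X - {x})"
    using CD(3) by (simp add: full_chains_def subset_chain_def)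
  moreover have "X - {x} \<in> C - {X}"
    using A Ax by auto
  ultimately show thesis
    using that[of x "C - {X}"] Ax \<open>X \<in> C\<close> by blast
qed

text \<open>
  Induction on the ground set by removing the top. If \<open>S = X\<close>, the missing point is one of
  \<open>card X\<close> points, and the shorter chain passes through its own top; otherwise the shorter chain still
  passes through \<open>S\<close>, so the missing point is one of the \<open>card X - card S\<close> points outside \<open>S\<close>.
\<close>

lemma card_full_chains_through_le:
  assumes "finite X" "S \<subseteq> X"
  shows "card {C \<in> full_chains X. S \<in> C} \<le> fact (card S) * fact (card X - card S)"
  using assms
proof (induction X arbitrary: S rule: finite_psubset_induct)
  case (psubset X)
  note fin = \<open>finite X\<close>
  let ?T = "\<lambda>X S. {C \<in> full_chains X. S \<in> C}"
  \<comment> \<open>common to both cases: \<open>P\<close> holds the candidates for the missing point,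
    and \<open>R x\<close> is a set through which the chain over \<open>X - {x}\<close> passes\<close>
  have step: "card (?T X S) \<le> card P * b"
    if P: "P \<subseteq> X"
      and cover: "?T X S \<subseteq> (\<Union>x\<in>P. insert X ` ?T (X - {x}) (R x))"
      and b: "\<And>x. x \<in> P \<Longrightarrow> card (?T (X - {x}) (R x)) \<le> b"
    for P R b
  proof -
    have fT: "finite (?T (X - {x}) (R x))" for x
      using finite_full_chains[of "X - {x}"] fin by simp
    have fP: "finite P"
      using P fin finite_subset by blast
    have "card (?T X S) \<le> card (\<Union>x\<in>P. insert X ` ?T (X - {x}) (R x))"
      using cover fP fT by (intro card_mono) auto
    also have "\<dots> \<le> (\<Sum>x\<in>P. card (insert X ` ?T (X - {x}) (R x)))"
      by (rule card_UN_le[OF fP])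
    also have "\<dots> \<le> (\<Sum>x\<in>P. b)"
      by (rule sum_mono) (rule order_trans[OF card_image_le[OF fT] b])
    finally show ?thesis
      by simp
  qed
  consider "X = {}" | "X \<noteq> {}" "S = X" | "S \<subset> X"
    using psubset.prems by blast
  then show ?case
  proof cases
    case 1
    have "?T X S \<subseteq> {{{}}}"
      using full_chainsD(1) 1 psubset.prems by fastforce
    then have "card (?T X S) \<le> 1"
      using card_mono[of "{{{}}}" "?T X S"] by simp
    then show ?thesis
      using 1 psubset.prems by simp
  next
    case 2
    have "card (?T X S) \<le> card X * fact (card X - 1)"
    proof (rule step)
      show "?T X S \<subseteq> (\<Union>x\<in>X. insert X ` ?T (X - {x}) (X - {x}))"
      proof
        fix C assume "C \<in> ?T X S"
        then obtain x D where "x \<in> X" "D \<in> full_chains (X - {x})" "X - {x} \<in> D"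
            "C = insert X D"
          using full_chain_remove_top[OF fin, of C] 2(1) by blast
        then show "C \<in> (\<Union>x\<in>X. insert X ` ?T (X - {x}) (X - {x}))"
          by blast
      qed
      fix x assume "x \<in> X"
      then show "card (?T (X - {x}) (X - {x})) \<le> fact (card X - 1)"
        using psubset.IH[of "X - {x}" "X - {x}"] fin by auto
    qed simp
    also have "\<dots> = fact (card X)"
      using 2 fin by (simp add: fact_reduce card_gt_0_iff)
    finally show ?thesis
      using 2 by simp
  next
    case 3
    then have less: "card S < card X"
      using fin psubset_card_mono by blast
    have "card (?T X S) \<le> card (X - S) * (fact (card S) * fact (card X - card S - 1))"
    proof (rule step)
      show "?T X S \<subseteq> (\<Union>x\<in>X - S. insert X ` ?T (X - {x}) S)"
      proof
        fix C assume C: "C \<in> ?T X S"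
        then obtain x D where D: "x \<in> X" "D \<in> full_chains (X - {x})" "C = insert X D"
          using full_chain_remove_top[OF fin, of C] 3 by blast
        moreover have "S \<in> D"
          using C D 3 by auto
        moreover have "x \<notin> S"
          using full_chainsD(1)[OF D(2)] \<open>S \<in> D\<close> by auto
        ultimately show "C \<in> (\<Union>x\<in>X - S. insert X ` ?T (X - {x}) S)"
          by blast
      qed
      fix x assume "x \<in> X - S"
      then show "card (?T (X - {x}) S) \<le> fact (card S) * fact (card X - card S - 1)"
        using psubset.IH[of "X - {x}" S] fin 3 by (auto simp: diff_commute)
    qed simp
    also have "card (X - S) = card X - card S"
      using psubset.prems fin by (simp add: card_Diff_subset finite_subset)
    also have "(card X - card S) * (fact (card S) * fact (card X - card S - 1))
        = fact (card S) * fact (card X - card S)"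
      using less by (simp add: fact_reduce[of "card X - card S"])
    finally show ?thesis .
  qed
qed

text \<open>
  Every maximal chain in \<open>\<A>\<close> passes through some \<open>k\<close>-set of \<open>\<A>\<close>, and
  \<open>k! (n - k)! (n choose k) = n!\<close>.
\<close>

lemma card_full_chains_level_le:
  assumes "finite X" "\<A> \<subseteq> Pow X" "k \<le> card X"
  shows "card {C \<in> full_chains X. C \<subseteq> \<A>} * (card X choose k)
    \<le> card {A \<in> \<A>. card A = k} * fact (card X)"
proof -
  let ?L = "{A \<in> \<A>. card A = k}"
  let ?T = "\<lambda>S. {C \<in> full_chains X. S \<in> C}"
  have fL: "finite ?L"
    using assms finite_subset[of \<A> "Pow X"] by simp
  have "{C \<in> full_chains X. C \<subseteq> \<A>} \<subseteq> (\<Union>S\<in>?L. ?T S)"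
  proof
    fix C assume C: "C \<in> {C \<in> full_chains X. C \<subseteq> \<A>}"
    then obtain A where "A \<in> C" "card A = k"
      using full_chain_level[OF assms(1) _ assms(3)] by blast
    with C show "C \<in> (\<Union>S\<in>?L. ?T S)"
      by blast
  qed
  then have "card {C \<in> full_chains X. C \<subseteq> \<A>} \<le> card (\<Union>S\<in>?L. ?T S)"
    using fL finite_full_chains[OF assms(1)] by (intro card_mono) auto
  also have "\<dots> \<le> (\<Sum>S\<in>?L. card (?T S))"
    by (rule card_UN_le[OF fL])
  also have "\<dots> \<le> (\<Sum>S\<in>?L. fact k * fact (card X - k))"
    using card_full_chains_through_le[OF assms(1)] assms(2) by (intro sum_mono) auto
  finally have "card {C \<in> full_chains X. C \<subseteq> \<A>}
      \<le> card ?L * (fact k * fact (card X - k))"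
    by simp
  then have "card {C \<in> full_chains X. C \<subseteq> \<A>} * (card X choose k)
      \<le> card ?L * (fact k * fact (card X - k)) * (card X choose k)"
    by (rule mult_le_mono1)
  also have "\<dots> = card ?L * fact (card X)"
    using binomial_fact_lemma[OF assms(3)] by (simp add: mult.assoc)
  finally show ?thesis .
qed

lemma card_full_chains_le:
  assumes "finite X" "\<A> \<subseteq> Pow X"
  shows "card {C \<in> full_chains X. C \<subseteq> \<A>} * 2 ^ card X \<le> card \<A> * fact (card X)"
proof -
  let ?c = "card {C \<in> full_chains X. C \<subseteq> \<A>}"
  have "?c * 2 ^ card X = (\<Sum>k\<le>card X. ?c * (card X choose k))"
    by (simp add: choose_row_sum flip: sum_distrib_left)
  also have "\<dots> \<le> (\<Sum>k\<le>card X. card {A \<in> \<A>. card A = k} * fact (card X))"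
    using card_full_chains_level_le[OF assms] by (intro sum_mono) simp
  also have "\<dots> = (\<Sum>k\<le>card X. card {A \<in> \<A>. card A = k}) * fact (card X)"
    by (simp add: sum_distrib_right)
  also have "(\<Sum>k\<le>card X. card {A \<in> \<A>. card A = k}) = card \<A>"
  proof -
    have "finite \<A>"
      using assms finite_subset[of \<A> "Pow X"] by simp
    moreover have "card ` \<A> \<subseteq> {..card X}"
      using assms by (auto intro: card_mono)
    ultimately show ?thesis
      using sum.group[of \<A> "{..card X}" card "\<lambda>_. 1::nat"] by simp
  qed
  finally show ?thesis .
qed

theorem lemma2:
  fixes n :: nat and \<alpha> :: real and \<A> :: "nat set set"
  assumes "n \<ge> 1"
    and "\<A> \<subseteq> Pow {1..n}"
    and "real (card \<A>) = \<alpha> * 2 ^ n"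
  shows "real (num_maximal_chains n \<A>) \<le> \<alpha> * fact n"
proof -
  have "num_maximal_chains n \<A> = card {C \<in> full_chains {1..n}. C \<subseteq> \<A>}"
    by (simp add: num_maximal_chains_def maximal_chain_def full_chains_def)
  then have "num_maximal_chains n \<A> * 2 ^ n \<le> card \<A> * fact n"
    using card_full_chains_le[OF _ assms(2)] by simp
  then have "real (num_maximal_chains n \<A> * 2 ^ n) \<le> real (card \<A> * fact n)"
    by (simp only: of_nat_le_iff)
  then have "real (num_maximal_chains n \<A>) * 2 ^ n \<le> (\<alpha> * fact n) * 2 ^ n"
    using assms(3) by (simp add: mult_ac)
  then show ?thesis
    by simp
qed

end
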